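(* Let $F:\mathbb{R}^n\to\mathbb{R}\cup\{+\infty\}$ be proper closed convex with minimum value $F^*$, let $\gamma>0$, and let $F_\gamma$ be a smooth approximation of $F$ satisfying the Smoothing Assumption (A.1–A.4 in the context) with operator $\mathcal{B}$ and constant $D\ge0$. Let $\alpha\in\mathbb{R}$ and let $(x_k)_{k\ge0}$ be generated by Algorithm 1 (in the context) with sampling parameter $\alpha$. Then, with $S_\alpha(\gamma)$ and $R_{1-\alpha}<\infty$ as in the context, $$\mathbb{E}[F(\mathcal{B}(x_k))]-F^*\ \le\ \frac{2S_\alpha(\gamma)R_{1-\alpha}^2}{k+4}+\gamma D.$$
   Context: Blocks: $U=[U_1,\dots,U_N]$ is a column permutation of the $n\times n$ identity matrix, $U_i\in\mathbb{R}^{n\times n_i}$, $\sum_in_i=n$, $x^{(i)}=U_i^Tx$. On each $\mathbb{R}^{n_i}$ some norm $\|\cdot\|_{(i)}$ is fixed. Smoothing Assumption: A.1: $F_\gamma^*=\min_xF_\gamma(x)$ satisfies $F_\gamma^*\le F^*$. A.2: there are operators $\mathcal{B},\mathcal{C}$ and a constant $D\ge0$ with $F(\mathcal{B}(x))-\gamma D\le F_\gamma(x)\le F(\mathcal{C}(x))$ for all $x\in\mathrm{dom}\,F$. A.3: the gradient of $F_\gamma$ is block coordinate-wise Lipschitz continuous on $\mathbb{R}^n$ with constants $L_i(F_\gamma)>0$: $\|U_i^T(\nabla F_\gamma(x+U_ih)-\nabla F_\gamma(x))\|_{(i)}\le L_i(F_\gamma)\|h\|_{(i)}$ for all $x\in\mathbb{R}^n$,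 $h\in\mathbb{R}^{n_i}$, $i=1,\dots,N$. A.4: $F_\gamma$ is convex. Notation: $S_\alpha(\gamma)=\sum_{i=1}^NL_i(F_\gamma)^\alpha$, $\|x\|_\alpha^2=\sum_{i=1}^NL_i(F_\gamma)^\alpha\|x^{(i)}\|_{(i)}^2$. Algorithm 1: given $x_0\in\mathrm{dom}\,F_\gamma$, for $k\ge0$: sample $i_k\in\{1,\dots,N\}$ with probabilities $\mathbb{P}[i_k=i]=L_i(F_\gamma)^\alpha/S_\alpha(\gamma)$ and set $x_{k+1}=x_k-\frac{1}{L_{i_k}(F_\gamma)}U_{i_k}U_{i_k}^T\nabla F_\gamma(x_k)$. $\bar X_\gamma^*$ is the set of minimizers of $F_\gamma$, and $R_{1-\alpha}=\max_{k\ge0}\min_{x_*\in\bar X_\gamma^*}\|x_k-x_*\|_{1-\alpha}$, which is assumed to be finite.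
   Formalization: Two added assumptions, without which the claim fails: each block norm ‖·‖_(i) is at least the Euclidean norm, and the left inequality of A.2, F(B(x))−γD ≤ F_γ(x), also holds at all iterates x_k, which may leave dom F. *)

theory Defs
  imports "HOL-Probability.Probability"
begin

subsection \<open>Extended-valued convex functions\<close>

definition effective_domain :: "('a \<Rightarrow> ereal) \<Rightarrow> 'a set" where
  "effective_domain F = {x. F x < \<infinity>}"

definition ereal_epigraph :: "('a \<Rightarrow> ereal) \<Rightarrow> ('a \<times> real) set" where
  "ereal_epigraph F = {(x, t). F x \<le> ereal t}"

definition proper_closed_convex :: "('a::euclidean_space \<Rightarrow> ereal) \<Rightarrow> bool" where
  "proper_closed_convex F \<longleftrightarrow>
     (\<forall>x. F x \<noteq> -\<infinity>) \<and> effective_domain F \<noteq> {} \<and>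
     closed (ereal_epigraph F) \<and> convex (ereal_epigraph F)"

definition minimizers :: "('a \<Rightarrow> 'b::order) \<Rightarrow> 'a set" where
  "minimizers f = {x. is_arg_min f (\<lambda>_. True) x}"

subsection \<open>Block structure\<close>

text \<open>
  A column permutation \<open>U = [U\<^sub>1, \<dots>, U\<^sub>N]\<close> of the identity matrix distributes the coordinates
  among \<open>N\<close> blocks; it is given here by the map \<open>blk\<close> sending a coordinate to its block.
  The space of the \<open>i\<close>-th block is identified with its image under \<open>U\<^sub>i\<close>, i.e. with the vectors
  supported on the coordinates of block \<open>i\<close>. Under this identification \<open>U\<^sub>i h\<close> is \<open>h\<close>, and both
  \<open>x\<^sup>(\<^sup>i\<^sup>) = U\<^sub>i\<^sup>T x\<close> and \<open>U\<^sub>i U\<^sub>i\<^sup>T x\<close> are \<open>block_part blk i x\<close>.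
\<close>

definition block_space :: "('n::finite \<Rightarrow> 'b) \<Rightarrow> 'b \<Rightarrow> (real^'n) set" where
  "block_space blk i = {h. \<forall>j. blk j \<noteq> i \<longrightarrow> h $ j = 0}"

definition block_part :: "('n::finite \<Rightarrow> 'b) \<Rightarrow> 'b \<Rightarrow> real^'n \<Rightarrow> real^'n" where
  "block_part blk i x = (\<chi> j. if blk j = i then x $ j else 0)"

definition is_norm_on :: "'a::real_vector set \<Rightarrow> ('a \<Rightarrow> real) \<Rightarrow> bool" where
  "is_norm_on V \<nu> \<longleftrightarrow>
     (\<forall>x\<in>V. 0 \<le> \<nu> x) \<and> (\<forall>x\<in>V. \<nu> x = 0 \<longleftrightarrow> x = 0) \<and>
     (\<forall>x\<in>V. \<forall>c. \<nu> (c *\<^sub>R x) = \<bar>c\<bar> * \<nu> x) \<and>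
     (\<forall>x\<in>V. \<forall>y\<in>V. \<nu> (x + y) \<le> \<nu> x + \<nu> y)"

definition weighted_norm ::
  "('n::finite \<Rightarrow> 'b::finite) \<Rightarrow> ('b \<Rightarrow> real^'n \<Rightarrow> real) \<Rightarrow> ('b \<Rightarrow> real) \<Rightarrow> real \<Rightarrow> real^'n \<Rightarrow> real" where
  "weighted_norm blk nrm L \<beta> x = sqrt (\<Sum>i\<in>UNIV. L i powr \<beta> * (nrm i (block_part blk i x))\<^sup>2)"

definition power_sum :: "('b::finite \<Rightarrow> real) \<Rightarrow> real \<Rightarrow> real" where
  "power_sum L \<alpha> = (\<Sum>i\<in>UNIV. L i powr \<alpha>)"

definition block_lipschitz_gradient ::
  "('n::finite \<Rightarrow> 'b) \<Rightarrow> ('b \<Rightarrow> real^'n \<Rightarrow> real) \<Rightarrow> ('b \<Rightarrow> real) \<Rightarrow> (real^'n \<Rightarrow> real^'n) \<Rightarrow> bool" where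
  "block_lipschitz_gradient blk nrm L G \<longleftrightarrow>
     (\<forall>i x. \<forall>h\<in>block_space blk i. nrm i (block_part blk i (G (x + h) - G x)) \<le> L i * nrm i h)"

subsection \<open>Randomized coordinate descent\<close>

text \<open>The iterate \<open>x\<^sub>k\<close> along a given sequence \<open>c\<close> of selected blocks, with gradient map \<open>G\<close>.\<close>

primrec cd_iterate ::
  "('n::finite \<Rightarrow> 'b) \<Rightarrow> ('b \<Rightarrow> real) \<Rightarrow> (real^'n \<Rightarrow> real^'n) \<Rightarrow> real^'n \<Rightarrow> (nat \<Rightarrow> 'b) \<Rightarrow> nat \<Rightarrow> real^'n" where
  "cd_iterate blk L G x0 c 0 = x0"
| "cd_iterate blk L G x0 c (Suc k) =
     cd_iterate blk L G x0 c k
       - (1 / L (c k)) *\<^sub>R block_part blk (c k) (G (cd_iterate blk L G x0 c k))"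

definition random_blocks :: "'w measure \<Rightarrow> (nat \<Rightarrow> 'w \<Rightarrow> 'b::finite) \<Rightarrow> ('b \<Rightarrow> real) \<Rightarrow> real \<Rightarrow> bool" where
  "random_blocks M idx L \<alpha> \<longleftrightarrow>
     prob_space M \<and>
     prob_space.indep_vars M (\<lambda>_. count_space UNIV) idx UNIV \<and>
     (\<forall>k i. measure M {\<omega> \<in> space M. idx k \<omega> = i} = L i powr \<alpha> / power_sum L \<alpha>)"

text \<open>
  The radius is a number although the iterates are random: the supremum is also taken over all
  realizations. Every finite sequence of blocks is selected with positive probability when all
  \<open>L i\<close> are positive, so this supremum is not affected by null sets.
\<close>

definition iterate_radius ::
  "'w measure \<Rightarrow> (nat \<Rightarrow> 'w \<Rightarrow> 'a::minus) \<Rightarrow> 'a set \<Rightarrow> ('a \<Rightarrow> real) \<Rightarrow> ereal" where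
  "iterate_radius M X Xs \<nu> = (SUP k. SUP \<omega>\<in>space M. INF xs\<in>Xs. ereal (\<nu> (X k \<omega> - xs)))"

text \<open>
  Expectation of an extended-real random variable. If the positive part has infinite expectation,
  the value is \<open>\<infinity>\<close> (in \<^typ>\<open>ereal\<close>, \<open>\<infinity> - \<infinity> = \<infinity>\<close>), so a finite upper bound is never vacuous.
\<close>

definition ereal_expectation :: "'w measure \<Rightarrow> ('w \<Rightarrow> ereal) \<Rightarrow> ereal" where
  "ereal_expectation M Z =
     enn2ereal (\<integral>\<^sup>+ \<omega>. e2ennreal (Z \<omega>) \<partial>M) - enn2ereal (\<integral>\<^sup>+ \<omega>. e2ennreal (- Z \<omega>) \<partial>M)"

end

theory Submission
  imports Defs
begin

text \<open>
  Write \<open>f\<close> for the smooth approximation, \<open>g\<close> for its gradient, \<open>S\<close> for the sum of the powers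
  \<open>L i powr \<alpha>\<close> and \<open>a k\<close> for the expected gap between \<open>f\<close> at the \<open>k\<close>-th iterate and the minimum of
  \<open>f\<close>. The proof establishes \<open>a (k + 1) \<le> a k - (a k)\<^sup>2 / A\<close> and \<open>a 0 \<le> A / 4\<close> with
  \<open>A = 2 * S * R\<^sup>2\<close>, which together yield \<open>a k \<le> A / (k + 4)\<close> (\<open>decreasing_quadratic_recursion\<close>). The approximation error \<open>\<gamma> * D\<close> and the
  comparison of the two minimum values are then added.

  The recursion combines two estimates. A step along block \<open>i\<close> lowers \<open>f\<close> by at least
  \<open>(norm p)\<^sup>2 / (2 * L i)\<close>, where \<open>p\<close> is the \<open>i\<close>-th part of the gradient; averaging with the sampling
  probabilities gives an expected decrease of \<open>q\<^sup>2 / (2 * S)\<close>, where \<open>q\<close> is the norm of the gradient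
  dual to the weighted norm with exponent \<open>1 - \<alpha>\<close> (\<open>expected_step_decrease\<close>). Convexity and the
  Cauchy-Schwarz inequality bound the gap by \<open>q * R\<close> (\<open>gap_le_gradient_times_dist\<close>), and Jensen's
  inequality moves the square outside the expectation. The initial bound comes from convexity as
  well: \<open>x\<close> is the average, with the sampling probabilities, of points that differ from a minimizer
  in one block only, and on each of these \<open>f\<close> has a quadratic upper bound (\<open>gap_le_weighted_dist\<close>).

  The delicate point is the decrease along a block. The Lipschitz condition measures both the
  gradient difference and the displacement in the same norm \<open>nrm i\<close>, whereas the step and the
  inner product are Euclidean, and replacing one norm by the other would cost a constant. For a
  quadratic \<open>f\<close> no constant is lost, because the largest eigenvalue of a symmetric matrix is at most
  its operator norm for any norm. The lemma \<open>monotone_bound_along\<close> carries this over to a convex \<open>f\<close>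
  without second derivatives: cocoercivity of the gradient makes every displacement that almost
  attains the best Euclidean constant an approximate eigenvector.
\<close>

section \<open>Convex functions with a gradient\<close>

locale convex_gradient =
  fixes f :: "'a::euclidean_space \<Rightarrow> real" and g :: "'a \<Rightarrow> 'a"
  assumes has_gradient: "\<And>x. GDERIV f x :> g x"
    and convex: "convex_on UNIV f"
begin

lemma has_derivative_along_line:
  "((\<lambda>t. f (x + t *\<^sub>R h)) has_real_derivative g (x + t *\<^sub>R h) \<bullet> h) (at t)"
proof -
  have f': "(f has_derivative (\<lambda>u. u \<bullet> g (x + t *\<^sub>R h))) (at (x + t *\<^sub>R h))"
    using has_gradient by (simp add: gderiv_def inner_commute)
  have line: "((\<lambda>t. x + t *\<^sub>R h) has_derivative (\<lambda>s. s *\<^sub>R h)) (at t)"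
    by (auto intro!: derivative_eq_intros)
  have eq: "(\<lambda>s. (s *\<^sub>R h) \<bullet> g (x + t *\<^sub>R h)) = (*) (g (x + t *\<^sub>R h) \<bullet> h)"
    by (simp add: fun_eq_iff inner_commute)
  show ?thesis
    using has_derivative_compose[of "\<lambda>t. x + t *\<^sub>R h", OF line f']
    unfolding has_field_derivative_def eq .
qed

lemma above_tangent: "f x + g x \<bullet> h \<le> f (x + h)"
proof -
  define \<phi> where "\<phi> t = f (x + t *\<^sub>R h)" for t
  have "convex_on UNIV \<phi>"
  proof (rule convex_onI)
    fix t r s :: real
    assume t: "0 < t" "t < 1"
    have "x + ((1 - t) *\<^sub>R r + t *\<^sub>R s) *\<^sub>R h = (1 - t) *\<^sub>R (x + r *\<^sub>R h) + t *\<^sub>R (x + s *\<^sub>R h)"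
      by (simp add: algebra_simps)
    then show "\<phi> ((1 - t) *\<^sub>R r + t *\<^sub>R s) \<le> (1 - t) * \<phi> r + t * \<phi> s"
      using t convex_onD[OF convex, of t "x + r *\<^sub>R h" "x + s *\<^sub>R h"] unfolding \<phi>_def by simp
  qed simp
  moreover have "(\<phi> has_real_derivative g x \<bullet> h) (at 0 within UNIV)"
    using has_derivative_along_line[of x h 0] unfolding \<phi>_def by simp
  ultimately have "\<phi> 1 - \<phi> 0 \<ge> (g x \<bullet> h) * (1 - 0)"
    by (intro convex_on_imp_above_tangent[where A = UNIV]) auto
  then show ?thesis by (simp add: \<phi>_def)
qed

lemma below_quadratic:
  assumes "\<And>t. 0 \<le> t \<Longrightarrow> t \<le> 1 \<Longrightarrow>
             (g (x + t *\<^sub>R h) - g x) \<bullet> (t *\<^sub>R h) \<le> \<Lambda> * (norm (t *\<^sub>R h))\<^sup>2"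
  shows "f (x + h) \<le> f x + g x \<bullet> h + \<Lambda> / 2 * (norm h)\<^sup>2"
proof -
  define \<psi> where "\<psi> t = f (x + t *\<^sub>R h) - t * (g x \<bullet> h) - \<Lambda> / 2 * t\<^sup>2 * (norm h)\<^sup>2" for t
  have "\<psi> 1 \<le> \<psi> 0"
  proof (rule DERIV_nonpos_imp_nonincreasing[of 0 1 \<psi>])
    fix t :: real
    assume t: "0 \<le> t" "t \<le> 1"
    have "(\<psi> has_real_derivative (g (x + t *\<^sub>R h) - g x) \<bullet> h - \<Lambda> * t * (norm h)\<^sup>2) (at t)"
      unfolding \<psi>_def
      by (auto intro!: derivative_eq_intros has_derivative_along_line simp: inner_diff_left)
    moreover have "(g (x + t *\<^sub>R h) - g x) \<bullet> h - \<Lambda> * t * (norm h)\<^sup>2 \<le> 0"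
    proof (cases "t = 0")
      case False
      then have "t > 0" using t by simp
      have "t * ((g (x + t *\<^sub>R h) - g x) \<bullet> h) \<le> t * (\<Lambda> * t * (norm h)\<^sup>2)"
        using assms[OF t] t by (simp add: power_mult_distrib power2_eq_square algebra_simps)
      then show ?thesis using \<open>t > 0\<close> by simp
    qed simp
    ultimately show "\<exists>y. (\<psi> has_real_derivative y) (at t) \<and> y \<le> 0" by blast
  qed simp
  then show ?thesis by (simp add: \<psi>_def)
qed

end

section \<open>The Lipschitz constant of the gradient along a subspace\<close>

text \<open>
  Only displacements in \<open>V\<close> are considered, and only the component of the gradient in \<open>V\<close>, which is
  what the orthogonal projection \<open>P\<close> extracts. Below, \<open>V\<close> is the space of one block.
\<close>

locale convex_gradient_on_subspace = convex_gradient f g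
  for f :: "'a::euclidean_space \<Rightarrow> real" and g :: "'a \<Rightarrow> 'a" +
  fixes V :: "'a set" and P :: "'a \<Rightarrow> 'a"
  assumes subspace: "subspace V"
    and linear_proj: "linear P"
    and proj_in: "\<And>u. P u \<in> V"
    and inner_proj: "\<And>u v. v \<in> V \<Longrightarrow> P u \<bullet> v = u \<bullet> v"
begin

lemma proj_id: "v \<in> V \<Longrightarrow> P v = v"
proof -
  assume v: "v \<in> V"
  then have "(P v - v) \<bullet> (P v - v) = 0"
    using inner_proj[of "P v - v" v] subspace_diff[OF subspace proj_in v]
    by (simp add: inner_diff_left)
  then show ?thesis by simp
qed

text \<open>
  The argument of Baillon and Haddad, carried out inside \<open>V\<close>: the difference of \<open>f\<close> and its tangent
  at \<open>x\<close> is nonnegative, so a gradient step from \<open>x + h\<close> decreases it by no more than its value at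
  \<open>x + h\<close>. Adding the resulting inequality to the one with the roles of \<open>x\<close> and \<open>x + h\<close> exchanged
  eliminates the function values.
\<close>

lemma cocoercive_along:
  assumes pos: "\<Lambda> > 0"
    and bound: "\<And>x h. h \<in> V \<Longrightarrow> (g (x + h) - g x) \<bullet> h \<le> \<Lambda> * (norm h)\<^sup>2"
    and h: "h \<in> V"
  shows "(norm (P (g (x + h) - g x)))\<^sup>2 \<le> \<Lambda> * ((g (x + h) - g x) \<bullet> h)"
proof -
  have upper: "f (x + h) \<le> f x + g x \<bullet> h + \<Lambda> / 2 * (norm h)\<^sup>2" if "h \<in> V" for x h
    using that by (intro below_quadratic bound subspace_scale[OF subspace])
  have half: "f x + g x \<bullet> h + (norm (P (g (x + h) - g x)))\<^sup>2 / (2 * \<Lambda>) \<le> f (x + h)"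
    if h: "h \<in> V" for x h
  proof -
    define w where "w = P (g (x + h) - g x)"
    \<comment> \<open>the gradient step; it minimizes the quadratic upper bound over \<open>V\<close>\<close>
    define s where "s = - (1 / \<Lambda>) *\<^sub>R w"
    have w: "w \<in> V" by (simp add: w_def proj_in)
    then have s: "s \<in> V" unfolding s_def by (intro subspace_scale[OF subspace])
    have "f x + g x \<bullet> (h + s) \<le> f (x + (h + s))" by (rule above_tangent)
    also have "\<dots> \<le> f (x + h) + g (x + h) \<bullet> s + \<Lambda> / 2 * (norm s)\<^sup>2"
      using upper[OF s, of "x + h"] by (simp add: add.assoc)
    finally have "f x + g x \<bullet> h \<le> f (x + h) + (g (x + h) - g x) \<bullet> s + \<Lambda> / 2 * (norm s)\<^sup>2"
      by (simp add: inner_diff_left inner_add_right)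
    also have "(g (x + h) - g x) \<bullet> s = w \<bullet> s"
      using inner_proj[OF s] by (simp add: w_def)
    also have "w \<bullet> s = - (norm w)\<^sup>2 / \<Lambda>"
      by (simp add: s_def dot_square_norm)
    also have "\<Lambda> / 2 * (norm s)\<^sup>2 = (norm w)\<^sup>2 / (2 * \<Lambda>)"
      using pos by (simp add: s_def power_mult_distrib power2_eq_square field_simps)
    finally show ?thesis using pos by (simp add: w_def field_simps)
  qed
  have neg: "- h \<in> V" using h by (rule subspace_neg[OF subspace])
  have flip: "norm (P (g x - g (x + h))) = norm (P (g (x + h) - g x))"
    by (metis linear_neg[OF linear_proj] minus_diff_eq norm_minus_cancel)
  have "(norm (P (g (x + h) - g x)))\<^sup>2 / (2 * \<Lambda>) + (norm (P (g (x + h) - g x)))\<^sup>2 / (2 * \<Lambda>)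
      \<le> (g (x + h) - g x) \<bullet> h"
    using half[OF h, of x] half[OF neg, of "x + h"] by (simp add: flip inner_diff_left)
  then show ?thesis using pos by (simp add: field_simps)
qed

lemma norm_on_bounded:
  assumes \<nu>: "is_norm_on V \<nu>"
  obtains c where "c > 0" "\<And>v. v \<in> V \<Longrightarrow> \<nu> v \<le> c * norm v"
proof -
  have nonneg: "0 \<le> \<nu> (P b)" for b using \<nu> proj_in unfolding is_norm_on_def by blast
  have tri: "\<nu> (\<Sum>b\<in>A. a b *\<^sub>R P b) \<le> (\<Sum>b\<in>A. \<bar>a b\<bar> * \<nu> (P b))" if "finite A" for a and A :: "'a set"
    using that
  proof induction
    case empty
    have "\<nu> 0 = 0" using \<nu> subspace_0[OF subspace] unfolding is_norm_on_def by blast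
    then show ?case by simp
  next
    case (insert b A)
    have 1: "a b *\<^sub>R P b \<in> V" "(\<Sum>b\<in>A. a b *\<^sub>R P b) \<in> V"
      by (auto intro!: subspace_sum[OF subspace] subspace_scale[OF subspace] proj_in)
    then have "\<nu> (a b *\<^sub>R P b + (\<Sum>b\<in>A. a b *\<^sub>R P b)) \<le> \<nu> (a b *\<^sub>R P b) + \<nu> (\<Sum>b\<in>A. a b *\<^sub>R P b)"
      using \<nu> by (simp add: is_norm_on_def)
    also have "\<nu> (a b *\<^sub>R P b) = \<bar>a b\<bar> * \<nu> (P b)"
      using \<nu> proj_in by (simp add: is_norm_on_def)
    finally show ?case using insert by simp
  qed
  define c where "c = (\<Sum>b\<in>Basis. \<nu> (P b))"
  have "\<nu> v \<le> (c + 1) * norm v" if v: "v \<in> V" for v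
  proof -
    have "v = P (\<Sum>b\<in>Basis. (v \<bullet> b) *\<^sub>R b)"
      by (simp add: euclidean_representation proj_id[OF v])
    also have "\<dots> = (\<Sum>b\<in>Basis. (v \<bullet> b) *\<^sub>R P b)"
      by (simp add: linear_sum[OF linear_proj] linear_scale[OF linear_proj])
    finally have "\<nu> v = \<nu> (\<Sum>b\<in>Basis. (v \<bullet> b) *\<^sub>R P b)" by simp
    also have "\<dots> \<le> (\<Sum>b\<in>Basis. \<bar>v \<bullet> b\<bar> * \<nu> (P b))" by (rule tri) simp
    also have "\<dots> \<le> (\<Sum>b\<in>Basis. norm v * \<nu> (P b))"
      by (intro sum_mono mult_right_mono nonneg Basis_le_norm)
    also have "\<dots> = c * norm v" by (simp add: c_def sum_distrib_left mult.commute)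
    finally show ?thesis by (simp add: distrib_right add_increasing2)
  qed
  moreover have "c + 1 > 0" using sum_nonneg[OF nonneg] by (simp add: c_def add_nonneg_pos nonneg sum_nonneg)
  ultimately show ?thesis by (rule that[rotated])
qed

text \<open>
  This replaces the fact that a symmetric matrix has spectral radius at most its operator norm for
  \<open>\<nu>\<close>. Let \<open>\<Lambda>\<close> be the best Euclidean constant. If \<open>h\<close> attains \<open>\<Lambda>\<close> up to \<open>\<epsilon>\<close> and \<open>w\<close> is the gradient
  difference along \<open>h\<close>, then cocoercivity gives
  \<open>(norm (\<Lambda> h - w))\<^sup>2 \<le> \<Lambda> * \<epsilon> * (norm h)\<^sup>2\<close>, so that \<open>w\<close> is nearly \<open>\<Lambda> h\<close>. Hence \<open>\<nu> w\<close> is nearly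
  \<open>\<Lambda> * \<nu> h\<close>, which by hypothesis is possible only for \<open>\<Lambda> \<le> L\<close>. Equivalence of \<open>\<nu>\<close> with the
  Euclidean norm makes \<open>\<Lambda>\<close> finite and turns the small Euclidean error into a small error in \<open>\<nu>\<close>;
  the constants of this equivalence disappear from the result.
\<close>

lemma monotone_bound_along:
  assumes \<nu>: "is_norm_on V \<nu>"
    and \<nu>_ge: "\<And>v. v \<in> V \<Longrightarrow> norm v \<le> \<nu> v"
    and L: "L > 0"
    and lipschitz: "\<And>x h. h \<in> V \<Longrightarrow> \<nu> (P (g (x + h) - g x)) \<le> L * \<nu> h"
    and h: "h \<in> V"
  shows "(g (x + h) - g x) \<bullet> h \<le> L * (norm h)\<^sup>2"
proof -
  obtain c where c: "c > 0" "\<And>v. v \<in> V \<Longrightarrow> \<nu> v \<le> c * norm v"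
    using norm_on_bounded[OF \<nu>] by blast
  define A where "A = {((g (x + h) - g x) \<bullet> h) / (norm h)\<^sup>2 | x h. h \<in> V \<and> h \<noteq> 0}"
  have "r \<le> L * c" if "r \<in> A" for r
  proof -
    obtain x h where r: "r = ((g (x + h) - g x) \<bullet> h) / (norm h)\<^sup>2" and h: "h \<in> V" "h \<noteq> 0"
      using \<open>r \<in> A\<close> unfolding A_def by blast
    have "(g (x + h) - g x) \<bullet> h = P (g (x + h) - g x) \<bullet> h" using inner_proj h by simp
    also have "\<dots> \<le> norm (P (g (x + h) - g x)) * norm h" by (rule norm_cauchy_schwarz)
    also have "\<dots> \<le> \<nu> (P (g (x + h) - g x)) * norm h"
      by (intro mult_right_mono \<nu>_ge proj_in) simp
    also have "\<dots> \<le> (L * \<nu> h) * norm h" by (intro mult_right_mono lipschitz h) simp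
    also have "\<dots> \<le> (L * (c * norm h)) * norm h"
      using L c(2)[OF h(1)] by (intro mult_right_mono mult_left_mono) auto
    finally show ?thesis using h by (simp add: r divide_simps power2_eq_square algebra_simps)
  qed
  then have bdd: "bdd_above A" by (rule bdd_aboveI)
  define \<Lambda> where "\<Lambda> = Sup A"
  have bound: "(g (x + h) - g x) \<bullet> h \<le> \<Lambda> * (norm h)\<^sup>2" if "h \<in> V" for x h
  proof (cases "h = 0")
    case False
    then have "((g (x + h) - g x) \<bullet> h) / (norm h)\<^sup>2 \<le> \<Lambda>"
      unfolding \<Lambda>_def using that by (intro cSup_upper bdd) (auto simp: A_def)
    then show ?thesis using False by (simp add: divide_simps)
  qed simp
  have "\<Lambda> \<le> L" if "A \<noteq> {}"
  proof (rule ccontr)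
    assume "\<not> \<Lambda> \<le> L"
    then have gap: "\<Lambda> - L > 0" by simp
    then have pos: "\<Lambda> > 0" using L by simp
    \<comment> \<open>half of the value at which the final estimate below would become an equality\<close>
    define \<epsilon> where "\<epsilon> = (\<Lambda> - L)\<^sup>2 / (2 * c\<^sup>2 * \<Lambda>)"
    have "\<epsilon> > 0" using gap pos c by (simp add: \<epsilon>_def)
    then have "\<Lambda> - \<epsilon> < Sup A" by (simp add: \<Lambda>_def)
    then obtain r where "r \<in> A" "\<Lambda> - \<epsilon> < r" using less_cSupD[OF \<open>A \<noteq> {}\<close>] by blast
    then obtain x h where h: "h \<in> V" "h \<noteq> 0"
      and "\<Lambda> - \<epsilon> < ((g (x + h) - g x) \<bullet> h) / (norm h)\<^sup>2"
      by (auto simp: A_def)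
    then have near: "(\<Lambda> - \<epsilon>) * (norm h)\<^sup>2 \<le> (g (x + h) - g x) \<bullet> h"
      by (simp add: divide_simps)
    define w where "w = P (g (x + h) - g x)"
    have w: "w \<in> V" by (simp add: w_def proj_in)
    have wh: "w \<bullet> h = (g (x + h) - g x) \<bullet> h" by (simp add: w_def inner_proj h)
    define d where "d = \<Lambda> *\<^sub>R h - w"
    have d: "d \<in> V" unfolding d_def
      by (intro subspace_diff[OF subspace] subspace_scale[OF subspace] h w)
    have "(norm d)\<^sup>2 = \<Lambda>\<^sup>2 * (norm h)\<^sup>2 - 2 * \<Lambda> * (w \<bullet> h) + (norm w)\<^sup>2"
      unfolding d_def power2_norm_eq_inner
      by (simp add: inner_diff_left inner_diff_right inner_commute power2_eq_square algebra_simps)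
    also have "(norm w)\<^sup>2 \<le> \<Lambda> * (w \<bullet> h)"
      unfolding wh unfolding w_def by (rule cocoercive_along[OF pos bound h(1)])
    also have "\<Lambda>\<^sup>2 * (norm h)\<^sup>2 - 2 * \<Lambda> * (w \<bullet> h) + \<Lambda> * (w \<bullet> h)
        = \<Lambda>\<^sup>2 * (norm h)\<^sup>2 - \<Lambda> * (w \<bullet> h)" by simp
    also have "\<dots> \<le> \<Lambda>\<^sup>2 * (norm h)\<^sup>2 - \<Lambda> * ((\<Lambda> - \<epsilon>) * (norm h)\<^sup>2)"
      using near pos by (simp add: wh)
    also have "\<dots> = \<Lambda> * \<epsilon> * (norm h)\<^sup>2" by (simp add: power2_eq_square algebra_simps)
    finally have d_small: "(norm d)\<^sup>2 \<le> \<Lambda> * \<epsilon> * (norm h)\<^sup>2" by simp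
    have "\<Lambda> * \<nu> h = \<nu> (\<Lambda> *\<^sub>R h)" using \<nu> h pos by (simp add: is_norm_on_def)
    also have "\<Lambda> *\<^sub>R h = d + w" by (simp add: d_def)
    also have "\<nu> (d + w) \<le> \<nu> d + \<nu> w" using \<nu> d w by (simp add: is_norm_on_def)
    also have "\<dots> \<le> c * norm d + L * \<nu> h"
      unfolding w_def using c d h lipschitz by (intro add_mono) auto
    finally have "(\<Lambda> - L) * \<nu> h \<le> c * norm d" by (simp add: algebra_simps)
    moreover have "(\<Lambda> - L) * norm h \<le> (\<Lambda> - L) * \<nu> h"
      using gap \<nu>_ge[OF h(1)] by simp
    ultimately have "(\<Lambda> - L) * norm h \<le> c * norm d" by simp
    then have "((\<Lambda> - L) * norm h)\<^sup>2 \<le> (c * norm d)\<^sup>2"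
      using gap by (intro power_mono) auto
    also have "\<dots> = c\<^sup>2 * (norm d)\<^sup>2" by (simp add: power_mult_distrib)
    also have "\<dots> \<le> c\<^sup>2 * (\<Lambda> * \<epsilon> * (norm h)\<^sup>2)" using d_small by (intro mult_left_mono) auto
    also have "\<dots> = (\<Lambda> - L)\<^sup>2 / 2 * (norm h)\<^sup>2"
      using c pos by (simp add: \<epsilon>_def)
    finally have "(\<Lambda> - L)\<^sup>2 * (norm h)\<^sup>2 \<le> (\<Lambda> - L)\<^sup>2 / 2 * (norm h)\<^sup>2"
      by (simp add: power_mult_distrib)
    moreover have "(\<Lambda> - L)\<^sup>2 * (norm h)\<^sup>2 > 0" using gap h by simp
    ultimately show False by (simp add: mult.commute)
  qed
  show ?thesis
  proof (cases "h = 0")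
    case False
    then have "A \<noteq> {}" using h by (auto simp: A_def)
    then have "\<Lambda> * (norm h)\<^sup>2 \<le> L * (norm h)\<^sup>2"
      using \<open>A \<noteq> {} \<Longrightarrow> \<Lambda> \<le> L\<close> by (intro mult_right_mono) auto
    then show ?thesis using bound[OF h, of x] by simp
  qed simp
qed

end

section \<open>Block coordinate steps\<close>

lemma block_part_in_block_space: "block_part blk i u \<in> block_space blk i"
  by (simp add: block_part_def block_space_def)

lemma linear_block_part: "linear (block_part blk i)"
  by (rule linearI) (auto simp: block_part_def vec_eq_iff)

lemma subspace_block_space: "subspace (block_space blk i)"
  by (auto simp: subspace_def block_space_def)

lemma inner_block_part: "v \<in> block_space blk i \<Longrightarrow> block_part blk i u \<bullet> v = u \<bullet> v"
  unfolding inner_vec_def by (rule sum.cong) (auto simp: block_part_def block_space_def)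

lemma sum_block_parts: "(\<Sum>i\<in>UNIV. block_part blk i u) = u"
  for blk :: "'n::finite \<Rightarrow> 'b::finite"
  by (simp add: vec_eq_iff block_part_def)

lemma inner_sum_block_parts:
  "u \<bullet> v = (\<Sum>i\<in>UNIV. block_part blk i u \<bullet> block_part blk i v)"
  for blk :: "'n::finite \<Rightarrow> 'b::finite"
proof -
  have "u \<bullet> v = (\<Sum>i\<in>UNIV. u \<bullet> block_part blk i v)"
    by (subst sum_block_parts[of blk v, symmetric]) (rule inner_sum_right)
  then show ?thesis by (simp add: inner_block_part block_part_in_block_space)
qed

lemma power_sum_pos: "(\<And>i. L i > 0) \<Longrightarrow> power_sum L \<alpha> > 0"
  unfolding power_sum_def by (intro sum_pos) (auto simp: less_imp_neq[symmetric])

text \<open>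
  The hypothesis that the block norms dominate the Euclidean norm fixes the scale: the bounds on the
  gap are proved with Euclidean lengths and stated with the weighted norm.
\<close>

locale block_smooth_convex = convex_gradient f g
  for f :: "real^'n::finite \<Rightarrow> real" and g :: "real^'n \<Rightarrow> real^'n" +
  fixes blk :: "'n \<Rightarrow> 'b::finite" and nrm :: "'b \<Rightarrow> real^'n \<Rightarrow> real" and L :: "'b \<Rightarrow> real"
  assumes block_norm: "\<And>i. is_norm_on (block_space blk i) (nrm i)"
    and norm_le_block_norm: "\<And>i h. h \<in> block_space blk i \<Longrightarrow> norm h \<le> nrm i h"
    and L_pos: "\<And>i. L i > 0"
    and block_lipschitz: "block_lipschitz_gradient blk nrm L g"
begin

lemma monotone_bound_block:
  assumes h: "h \<in> block_space blk i"
  shows "(g (x + h) - g x) \<bullet> h \<le> L i * (norm h)\<^sup>2"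
proof -
  interpret convex_gradient_on_subspace f g "block_space blk i" "block_part blk i"
    by (intro convex_gradient_on_subspace.intro convex_gradient_on_subspace_axioms.intro
          convex_gradient_axioms)
      (simp_all add: subspace_block_space linear_block_part block_part_in_block_space inner_block_part)
  show ?thesis
    using block_lipschitz h
    by (intro monotone_bound_along[OF block_norm norm_le_block_norm L_pos])
      (auto simp: block_lipschitz_gradient_def)
qed

lemma below_block_quadratic:
  assumes "h \<in> block_space blk i"
  shows "f (x + h) \<le> f x + g x \<bullet> h + L i / 2 * (norm h)\<^sup>2"
  using assms by (intro below_quadratic monotone_bound_block subspace_scale[OF subspace_block_space])

lemma block_step_decrease:
  "f (x - (1 / L i) *\<^sub>R block_part blk i (g x))
     \<le> f x - (norm (block_part blk i (g x)))\<^sup>2 / (2 * L i)"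
proof -
  define p where "p = block_part blk i (g x)"
  define h where "h = - (1 / L i) *\<^sub>R p"
  have h: "h \<in> block_space blk i"
    unfolding h_def p_def
    by (intro subspace_scale[OF subspace_block_space] block_part_in_block_space)
  have "g x \<bullet> h = p \<bullet> h" using inner_block_part[OF h] by (simp add: p_def)
  then have "g x \<bullet> h = - (norm p)\<^sup>2 / L i" by (simp add: h_def dot_square_norm)
  moreover have "L i / 2 * (norm h)\<^sup>2 = (norm p)\<^sup>2 / (2 * L i)"
    using L_pos[of i] by (simp add: h_def power_mult_distrib power2_eq_square field_simps)
  ultimately have "f (x + h) \<le> f x - (norm p)\<^sup>2 / (2 * L i)"
    using below_block_quadratic[OF h, of x] by simp
  then show ?thesis by (simp add: h_def p_def)
qed

lemma gradient_zero_at_minimizer: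
  assumes "z \<in> minimizers f"
  shows "g z = 0"
proof -
  have "block_part blk i (g z) = 0" for i
  proof -
    have "f z \<le> f (z - (1 / L i) *\<^sub>R block_part blk i (g z))"
      using assms by (simp add: minimizers_def is_arg_min_linorder)
    then have "(norm (block_part blk i (g z)))\<^sup>2 / (2 * L i) \<le> 0"
      using block_step_decrease[of z i] by simp
    then show ?thesis using L_pos[of i] by (simp add: divide_le_0_iff)
  qed
  then show ?thesis using sum_block_parts[of blk "g z"] by simp
qed

lemma sum_powr_norm_le_weighted_norm:
  "(\<Sum>i\<in>UNIV. L i powr \<beta> * (norm (block_part blk i d))\<^sup>2) \<le> (weighted_norm blk nrm L \<beta> d)\<^sup>2"
proof -
  have "(\<Sum>i\<in>UNIV. L i powr \<beta> * (norm (block_part blk i d))\<^sup>2)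
      \<le> (\<Sum>i\<in>UNIV. L i powr \<beta> * (nrm i (block_part blk i d))\<^sup>2)"
    by (intro sum_mono mult_left_mono power_mono norm_le_block_norm block_part_in_block_space) auto
  also have "\<dots> = (weighted_norm blk nrm L \<beta> d)\<^sup>2"
    unfolding weighted_norm_def by (rule real_sqrt_pow2[symmetric]) (simp add: sum_nonneg)
  finally show ?thesis .
qed

text \<open>
  Since only single blocks have a quadratic upper bound, \<open>x\<close> is written as the average of the points
  \<open>y i\<close> obtained from \<open>z\<close> by moving along block \<open>i\<close> alone, stretched by the inverse of the weight
  \<open>p i\<close>. With the sampling probabilities as weights, the stretched quadratic terms carry exactly the
  coefficients \<open>L i powr (1 - \<alpha>)\<close>.
\<close>

lemma gap_le_weighted_dist:
  assumes z: "z \<in> minimizers f"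
  shows "f x - f z \<le> power_sum L \<alpha> / 2 * (weighted_norm blk nrm L (1 - \<alpha>) (x - z))\<^sup>2"
proof -
  define S where "S = power_sum L \<alpha>"
  have S: "S > 0" unfolding S_def by (rule power_sum_pos[OF L_pos])
  define p where "p i = L i powr \<alpha> / S" for i
  have p: "p i > 0" for i using S L_pos[of i] by (simp add: p_def)
  have sum_p: "(\<Sum>i\<in>UNIV. p i) = 1"
    using S by (simp add: p_def sum_divide_distrib[symmetric] S_def power_sum_def)
  define d where "d i = block_part blk i (x - z)" for i
  define y where "y i = z + (1 / p i) *\<^sub>R d i" for i
  have "(\<Sum>i\<in>UNIV. p i *\<^sub>R y i) = (\<Sum>i\<in>UNIV. p i *\<^sub>R z + d i)"
    using p by (intro sum.cong) (auto simp: y_def scaleR_add_right less_imp_neq[symmetric])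
  also have "\<dots> = x"
    by (simp add: sum.distrib scaleR_sum_left[symmetric] sum_p d_def sum_block_parts)
  finally have x: "x = (\<Sum>i\<in>UNIV. p i *\<^sub>R y i)" ..
  have "f x \<le> (\<Sum>i\<in>UNIV. p i * f (y i))"
    unfolding x using p by (intro convex_on_sum[OF _ _ convex]) (auto simp: sum_p less_imp_le)
  also have "\<dots> \<le> (\<Sum>i\<in>UNIV. p i * f z + S / 2 * (L i powr (1 - \<alpha>) * (norm (d i))\<^sup>2))"
  proof (rule sum_mono)
    fix i
    have "f (y i) \<le> f z + L i / 2 * (norm ((1 / p i) *\<^sub>R d i))\<^sup>2"
      using below_block_quadratic[of "(1 / p i) *\<^sub>R d i" i z] gradient_zero_at_minimizer[OF z]
      by (simp add: y_def d_def subspace_scale[OF subspace_block_space] block_part_in_block_space)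
    then have "p i * f (y i) \<le> p i * (f z + L i / 2 * (norm ((1 / p i) *\<^sub>R d i))\<^sup>2)"
      using p[of i] by (intro mult_left_mono) auto
    also have "\<dots> = p i * f z + (L i / p i) / 2 * (norm (d i))\<^sup>2"
      using p[of i] by (simp add: power_mult_distrib power_divide power2_eq_square field_simps)
    also have "L i / p i = S * L i powr (1 - \<alpha>)"
      using L_pos[of i] S by (simp add: p_def powr_diff)
    finally show "p i * f (y i) \<le> p i * f z + S / 2 * (L i powr (1 - \<alpha>) * (norm (d i))\<^sup>2)"
      by simp
  qed
  also have "\<dots> = f z + S / 2 * (\<Sum>i\<in>UNIV. L i powr (1 - \<alpha>) * (norm (d i))\<^sup>2)"
    unfolding sum.distrib sum_distrib_right[symmetric] sum_distrib_left[symmetric] sum_p by simp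
  also have "\<dots> \<le> f z + S / 2 * (weighted_norm blk nrm L (1 - \<alpha>) (x - z))\<^sup>2"
    using S unfolding d_def
    by (intro add_left_mono mult_left_mono sum_powr_norm_le_weighted_norm) auto
  finally show ?thesis by (simp add: S_def)
qed

text \<open>
  Dual to the weighted norm with exponent \<open>\<beta>\<close> when the blocks are measured in the Euclidean norm.
\<close>

definition dual_gradient_norm :: "real \<Rightarrow> real^'n \<Rightarrow> real" where
  "dual_gradient_norm \<beta> x = sqrt (\<Sum>i\<in>UNIV. L i powr - \<beta> * (norm (block_part blk i (g x)))\<^sup>2)"

lemma dual_gradient_norm_nonneg: "dual_gradient_norm \<beta> x \<ge> 0"
  by (simp add: dual_gradient_norm_def sum_nonneg)

lemma power2_dual_gradient_norm:
  "(dual_gradient_norm \<beta> x)\<^sup>2 = (\<Sum>i\<in>UNIV. L i powr - \<beta> * (norm (block_part blk i (g x)))\<^sup>2)"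
  unfolding dual_gradient_norm_def by (rule real_sqrt_pow2) (simp add: sum_nonneg)

text \<open>
  The tangent bound, followed by the Cauchy-Schwarz inequality over the blocks with the weight
  \<open>L i powr \<beta>\<close> split evenly between the two factors.
\<close>

lemma gap_le_gradient_times_dist:
  "f x - f z \<le> dual_gradient_norm \<beta> x * weighted_norm blk nrm L \<beta> (x - z)"
proof -
  have half_powr: "(L i powr (\<delta> / 2))\<^sup>2 = L i powr \<delta>" for i \<delta>
    by (simp add: power2_eq_square powr_add[symmetric])
  define p q where "p i = block_part blk i (g x)" and "q i = block_part blk i (x - z)" for i
  have "f x - f z \<le> g x \<bullet> (x - z)"
    using above_tangent[of x "z - x"] by (simp add: inner_diff_right)
  also have "\<dots> = (\<Sum>i\<in>UNIV. p i \<bullet> q i)"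
    unfolding p_def q_def by (rule inner_sum_block_parts)
  also have "\<dots> \<le> (\<Sum>i\<in>UNIV. \<bar>L i powr (- \<beta> / 2) * norm (p i)\<bar> * \<bar>L i powr (\<beta> / 2) * norm (q i)\<bar>)"
  proof (rule sum_mono)
    fix i
    have "L i powr (- \<beta> / 2) * L i powr (\<beta> / 2) = 1"
      using L_pos[of i] by (simp add: powr_add[symmetric])
    then have "\<bar>L i powr (- \<beta> / 2) * norm (p i)\<bar> * \<bar>L i powr (\<beta> / 2) * norm (q i)\<bar> = norm (p i) * norm (q i)"
      by (metis abs_mult abs_norm_cancel mult.assoc mult.left_commute mult_1 abs_one)
    then show "p i \<bullet> q i \<le> \<bar>L i powr (- \<beta> / 2) * norm (p i)\<bar> * \<bar>L i powr (\<beta> / 2) * norm (q i)\<bar>"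
      by (metis norm_cauchy_schwarz)
  qed
  also have "\<dots> \<le> L2_set (\<lambda>i. L i powr (- \<beta> / 2) * norm (p i)) UNIV
                  * L2_set (\<lambda>i. L i powr (\<beta> / 2) * norm (q i)) UNIV"
    by (rule L2_set_mult_ineq)
  also have "L2_set (\<lambda>i. L i powr (- \<beta> / 2) * norm (p i)) UNIV = dual_gradient_norm \<beta> x"
    unfolding L2_set_def dual_gradient_norm_def p_def
    by (simp add: power_mult_distrib half_powr[of _ "- \<beta>", simplified])
  also have "dual_gradient_norm \<beta> x * L2_set (\<lambda>i. L i powr (\<beta> / 2) * norm (q i)) UNIV
      \<le> dual_gradient_norm \<beta> x * weighted_norm blk nrm L \<beta> (x - z)"
  proof (rule mult_left_mono[OF _ dual_gradient_norm_nonneg])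
    have "(L2_set (\<lambda>i. L i powr (\<beta> / 2) * norm (q i)) UNIV)\<^sup>2
        = (\<Sum>i\<in>UNIV. L i powr \<beta> * (norm (q i))\<^sup>2)"
      unfolding L2_set_def
      by (simp add: sum_nonneg power_mult_distrib half_powr)
    also have "\<dots> \<le> (weighted_norm blk nrm L \<beta> (x - z))\<^sup>2"
      unfolding q_def by (rule sum_powr_norm_le_weighted_norm)
    finally show "L2_set (\<lambda>i. L i powr (\<beta> / 2) * norm (q i)) UNIV \<le> weighted_norm blk nrm L \<beta> (x - z)"
      by (rule power2_le_imp_le) (simp add: weighted_norm_def sum_nonneg)
  qed
  finally show ?thesis .
qed

text \<open>
  The probability \<open>L i powr \<alpha> / S\<close> times the decrease with denominator \<open>2 * L i\<close> produces the weight
  \<open>L i powr - (1 - \<alpha>)\<close>: this is why sampling with parameter \<open>\<alpha>\<close> belongs to the radius with exponent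
  \<open>1 - \<alpha>\<close>.
\<close>

lemma expected_step_decrease:
  "(\<Sum>i\<in>UNIV. L i powr \<alpha> / power_sum L \<alpha> * f (x - (1 / L i) *\<^sub>R block_part blk i (g x)))
     \<le> f x - (dual_gradient_norm (1 - \<alpha>) x)\<^sup>2 / (2 * power_sum L \<alpha>)"
proof -
  define S where "S = power_sum L \<alpha>"
  have S: "S > 0" unfolding S_def by (rule power_sum_pos[OF L_pos])
  define u where "u i = (norm (block_part blk i (g x)))\<^sup>2" for i
  have "(\<Sum>i\<in>UNIV. L i powr \<alpha> / S * f (x - (1 / L i) *\<^sub>R block_part blk i (g x)))
     \<le> (\<Sum>i\<in>UNIV. L i powr \<alpha> / S * (f x - u i / (2 * L i)))"
    using S unfolding u_def by (intro sum_mono mult_left_mono block_step_decrease) auto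
  also have "\<dots> = (\<Sum>i\<in>UNIV. L i powr \<alpha> / S * f x - L i powr - (1 - \<alpha>) * u i / (2 * S))"
  proof (rule sum.cong)
    fix i
    have "L i powr - (1 - \<alpha>) = L i powr \<alpha> / L i" using L_pos[of i] by (simp add: powr_diff)
    then show "L i powr \<alpha> / S * (f x - u i / (2 * L i))
        = L i powr \<alpha> / S * f x - L i powr - (1 - \<alpha>) * u i / (2 * S)"
      using L_pos[of i] S by (simp add: field_simps)
  qed simp
  also have "\<dots> = (\<Sum>i\<in>UNIV. L i powr \<alpha>) / S * f x - (\<Sum>i\<in>UNIV. L i powr - (1 - \<alpha>) * u i) / (2 * S)"
    by (simp add: sum_subtractf sum_divide_distrib sum_distrib_right)
  also have "(\<Sum>i\<in>UNIV. L i powr \<alpha>) / S = 1" using S by (simp add: S_def power_sum_def)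
  finally show ?thesis by (simp add: power2_dual_gradient_norm u_def S_def)
qed

end

section \<open>Recursions driven by independent random choices\<close>

text \<open>
  The state space carries no structure. As the choices range over a finite type, each state takes
  only finitely many values, so every real function of it is measurable and integrable, whatever the
  update \<open>T\<close>.
\<close>

locale random_recursion = prob_space M
  for M :: "'w measure" +
  fixes idx :: "nat \<Rightarrow> 'w \<Rightarrow> 'b::finite" and p :: "'b \<Rightarrow> real"
    and T :: "'b \<Rightarrow> 's \<Rightarrow> 's" and s0 :: 's and H :: "(nat \<Rightarrow> 'b) \<Rightarrow> nat \<Rightarrow> 's"
  assumes indep: "indep_vars (\<lambda>_. count_space UNIV) idx UNIV"
    and prob_idx: "\<And>k i. prob {\<omega> \<in> space M. idx k \<omega> = i} = p i"
    and H_0: "\<And>c. H c 0 = s0"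
    and H_Suc: "\<And>c k. H c (Suc k) = T (c k) (H c k)"
begin

definition state :: "nat \<Rightarrow> 'w \<Rightarrow> 's" where
  "state k \<omega> = H (\<lambda>m. idx m \<omega>) k"

lemma state_Suc: "state (Suc k) \<omega> = T (idx k \<omega>) (state k \<omega>)"
  by (simp add: state_def H_Suc)

lemma H_cong: "(\<And>m. m < k \<Longrightarrow> c m = c' m) \<Longrightarrow> H c k = H c' k"
  by (induction k) (auto simp: H_0 H_Suc)

lemma finite_range_H: "finite (range (\<lambda>c. H c k))"
proof (induction k)
  case (Suc k)
  have "range (\<lambda>c. H c (Suc k)) \<subseteq> (\<Union>i\<in>UNIV. T i ` range (\<lambda>c. H c k))"
    by (auto simp: H_Suc)
  then show ?case by (rule finite_subset) (simp add: Suc)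
qed (simp add: H_0)

lemma measurable_H:
  "j \<le> k \<Longrightarrow> (\<lambda>c. H c j) \<in> measurable (PiM {..<k} (\<lambda>_. count_space UNIV)) (count_space UNIV)"
proof (induction j)
  case (Suc j)
  have idx: "(\<lambda>c. c j) \<in> measurable (PiM {..<k} (\<lambda>_. count_space UNIV)) (count_space UNIV)"
    using Suc.prems by (intro measurable_component_singleton) auto
  have T: "(\<lambda>c. T i (H c j)) \<in> measurable (PiM {..<k} (\<lambda>_. count_space UNIV)) (count_space UNIV)" for i
    by (rule measurable_compose[OF Suc.IH]) (use Suc.prems in auto)
  show ?case
    unfolding H_Suc using measurable_compose_countable'[OF T idx countable_finite[OF finite]] .
qed (simp add: H_0)

lemma idx_measurable: "idx k \<in> measurable M (count_space UNIV)"
  using indep by (auto simp: indep_vars_def2)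

lemma state_eq_restrict: "state k \<omega> = H (\<lambda>m\<in>{..<k}. idx m \<omega>) k"
  unfolding state_def by (rule H_cong) simp

lemma state_measurable: "state k \<in> measurable M (count_space UNIV)"
proof -
  have "(\<lambda>\<omega>. \<lambda>m\<in>{..<k}. idx m \<omega>) \<in> measurable M (PiM {..<k} (\<lambda>_. count_space UNIV))"
    by (intro measurable_restrict idx_measurable)
  from measurable_compose[OF this measurable_H[OF order_refl]] show ?thesis
    unfolding state_eq_restrict[abs_def] .
qed

lemma integrable_state: "integrable M (\<lambda>\<omega>. \<phi> (state k \<omega>))" for \<phi> :: "'s \<Rightarrow> real"
proof (rule integrable_const_bound)
  let ?R = "(\<lambda>s. \<bar>\<phi> s\<bar>) ` range (\<lambda>c. H c k)"
  have "\<bar>\<phi> (state k \<omega>)\<bar> \<le> Max ?R" for \<omega>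
    using finite_range_H[of k] by (intro Max_ge) (auto simp: state_def)
  then show "AE \<omega> in M. norm (\<phi> (state k \<omega>)) \<le> Max ?R" by simp
  show "(\<lambda>\<omega>. \<phi> (state k \<omega>)) \<in> borel_measurable M"
    by (rule measurable_compose[OF state_measurable]) simp
qed

text \<open>
  The \<open>k\<close>-th state is a function of the choices before the \<open>k\<close>-th one. Independence is expressed
  through real functions because \<^const>\<open>prob_space.indep_var\<close> relates variables of the same type.
\<close>

lemma indep_state_idx:
  fixes u :: "'s \<Rightarrow> real" and v :: "'b \<Rightarrow> real"
  shows "indep_var borel (\<lambda>\<omega>. u (state k \<omega>)) borel (\<lambda>\<omega>. v (idx k \<omega>))"
proof -
  have "indep_var (PiM {..<k} (\<lambda>_. count_space UNIV)) (\<lambda>\<omega>. \<lambda>m\<in>{..<k}. idx m \<omega>)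
                  (PiM {k} (\<lambda>_. count_space UNIV)) (\<lambda>\<omega>. \<lambda>m\<in>{k}. idx m \<omega>)"
    by (rule indep_var_restrict[OF indep]) auto
  moreover have "(\<lambda>c. u (H c k)) \<in> borel_measurable (PiM {..<k} (\<lambda>_. count_space UNIV))"
    by (rule measurable_compose[OF measurable_H[OF order_refl]]) simp
  moreover have "(\<lambda>c. v (c k)) \<in> borel_measurable (PiM {k} (\<lambda>_. count_space UNIV))"
    by (rule measurable_compose[OF measurable_component_singleton]) auto
  ultimately have "indep_var borel ((\<lambda>c. u (H c k)) \<circ> (\<lambda>\<omega>. \<lambda>m\<in>{..<k}. idx m \<omega>))
                  borel ((\<lambda>c. v (c k)) \<circ> (\<lambda>\<omega>. \<lambda>m\<in>{k}. idx m \<omega>))"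
    by (rule indep_var_compose)
  then show ?thesis unfolding state_eq_restrict by (simp add: comp_def)
qed

text \<open>
  This takes the place of conditioning on the current state: after splitting by the value of the
  current choice, each summand is a product of independent variables.
\<close>

lemma expectation_state_Suc:
  fixes \<phi> :: "'s \<Rightarrow> real"
  shows "expectation (\<lambda>\<omega>. \<phi> (state (Suc k) \<omega>)) = expectation (\<lambda>\<omega>. \<Sum>i\<in>UNIV. p i * \<phi> (T i (state k \<omega>)))"
proof -
  define e :: "'b \<Rightarrow> 'b \<Rightarrow> real" where "e i j = (if j = i then 1 else 0)" for i j
  have e_int: "integrable M (\<lambda>\<omega>. e i (idx k \<omega>))" for i
    by (rule integrable_const_bound[where B = 1])
      (auto simp: e_def intro!: measurable_compose[OF idx_measurable])
  have e_eq: "expectation (\<lambda>\<omega>. e i (idx k \<omega>)) = p i" for i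
  proof -
    have "expectation (\<lambda>\<omega>. e i (idx k \<omega>)) = expectation (indicator {\<omega> \<in> space M. idx k \<omega> = i})"
      by (rule Bochner_Integration.integral_cong) (auto simp: e_def indicator_def)
    also have "\<dots> = prob {\<omega> \<in> space M. idx k \<omega> = i}" by (simp add: Int_absorb2)
    finally show ?thesis by (simp add: prob_idx)
  qed
  note ind = indep_state_idx[of "\<lambda>s. \<phi> (T i s)" k "e i" for i]
  note int = integrable_state[of "\<lambda>s. \<phi> (T i s)" k for i]
  have "expectation (\<lambda>\<omega>. \<phi> (state (Suc k) \<omega>))
      = expectation (\<lambda>\<omega>. \<Sum>i\<in>UNIV. \<phi> (T i (state k \<omega>)) * e i (idx k \<omega>))"
    by (simp add: state_Suc e_def if_distrib cong: if_cong)
  also have "\<dots> = (\<Sum>i\<in>UNIV. expectation (\<lambda>\<omega>. \<phi> (T i (state k \<omega>)) * e i (idx k \<omega>)))"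
    by (intro Bochner_Integration.integral_sum indep_var_integrable ind int e_int)
  also have "\<dots> = (\<Sum>i\<in>UNIV. expectation (\<lambda>\<omega>. \<phi> (T i (state k \<omega>))) * p i)"
    by (simp add: indep_var_lebesgue_integral[OF ind int e_int] e_eq)
  also have "\<dots> = expectation (\<lambda>\<omega>. \<Sum>i\<in>UNIV. p i * \<phi> (T i (state k \<omega>)))"
    by (subst Bochner_Integration.integral_sum) (auto intro!: integrable_mult_right int simp: mult.commute)
  finally show ?thesis .
qed

lemma expectation_squared_le: "(expectation (\<lambda>\<omega>. \<phi> (state k \<omega>)))\<^sup>2 \<le> expectation (\<lambda>\<omega>. (\<phi> (state k \<omega>))\<^sup>2)"
  for \<phi> :: "'s \<Rightarrow> real"
  using variance_positive[of "\<lambda>\<omega>. \<phi> (state k \<omega>)"]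
    variance_eq[OF integrable_state[of \<phi> k] integrable_state[of "\<lambda>s. (\<phi> s)\<^sup>2" k]] by simp

end

section \<open>Expectation, radius and the rate\<close>

lemma ereal_expectation_ereal:
  fixes r :: "'w \<Rightarrow> real"
  assumes "integrable M r"
  shows "ereal_expectation M (\<lambda>\<omega>. ereal (r \<omega>)) = ereal (\<integral>\<omega>. r \<omega> \<partial>M)"
proof -
  have "(\<integral>\<^sup>+ \<omega>. ennreal (r \<omega>) \<partial>M) < \<infinity>" "(\<integral>\<^sup>+ \<omega>. ennreal (- r \<omega>) \<partial>M) < \<infinity>"
    using assms by (auto simp: real_integrable_def less_top)
  then show ?thesis
    unfolding ereal_expectation_def real_lebesgue_integral_def[OF assms]
    by (cases "\<integral>\<^sup>+ \<omega>. ennreal (r \<omega>) \<partial>M" "\<integral>\<^sup>+ \<omega>. ennreal (- r \<omega>) \<partial>M" rule: ennreal2_cases)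
      (auto simp: e2ennreal_ereal)
qed

text \<open>
  The infimum over \<open>Xs\<close> need not be attained a priori, so the radius is used through lower bounds
  that hold for all points of \<open>Xs\<close> at once.
\<close>

lemma le_iterate_radius:
  assumes radius: "iterate_radius M X Xs \<nu> = ereal R"
    and \<omega>: "\<omega> \<in> space M"
    and lower: "\<And>z. z \<in> Xs \<Longrightarrow> t \<le> \<nu> (X k \<omega> - z)"
  shows "t \<le> R"
proof -
  have "ereal t \<le> (INF z\<in>Xs. ereal (\<nu> (X k \<omega> - z)))"
    by (rule INF_greatest) (simp add: lower)
  also have "\<dots> \<le> iterate_radius M X Xs \<nu>"
    unfolding iterate_radius_def using \<omega> by (intro SUP_upper2[of k] SUP_upper2[of \<omega>]) auto
  finally show ?thesis by (simp add: radius)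
qed

text \<open>
  The map \<open>t \<mapsto> t - t\<^sup>2 / A\<close> increases up to \<open>A / 2\<close>, so the bound for \<open>k\<close> may be inserted into the
  recursion; the induction closes because \<open>(k + 3) * (k + 5) \<le> (k + 4)\<^sup>2\<close>.
\<close>

lemma decreasing_quadratic_recursion:
  fixes a :: "nat \<Rightarrow> real"
  assumes A: "A > 0" and a0: "a 0 \<le> A / 4"
    and step: "\<And>k. a (Suc k) \<le> a k - (a k)\<^sup>2 / A"
  shows "a k \<le> A / (real k + 4)"
proof (induction k)
  case (Suc k)
  define b where "b = A / (real k + 4)"
  have "b \<le> A / 2" using A by (auto simp: b_def divide_simps)
  moreover have "a k \<le> b" using Suc by (simp add: b_def)
  ultimately have "0 \<le> (b - a k) * (A - (b + a k))"
    by (intro mult_nonneg_nonneg) auto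
  then have "a k * A - (a k)\<^sup>2 \<le> b * A - b\<^sup>2" by (simp add: power2_eq_square algebra_simps)
  then have "(a k * A - (a k)\<^sup>2) / A \<le> (b * A - b\<^sup>2) / A" using A by (intro divide_right_mono) auto
  then have "a k - (a k)\<^sup>2 / A \<le> b - b\<^sup>2 / A" using A by (simp add: diff_divide_distrib)
  also have "b - b\<^sup>2 / A = A * ((real k + 3) / (real k + 4)\<^sup>2)"
    using A by (simp add: b_def divide_simps power2_eq_square) (simp add: algebra_simps)
  also have "(real k + 3) / (real k + 4)\<^sup>2 \<le> 1 / (real k + 5)"
    by (simp add: divide_simps power2_eq_square) (simp add: algebra_simps)
  finally show ?case using step[of k] A by (simp add: add.commute)
qed (use a0 in simp)

section \<open>Convergence rate of randomized coordinate descent\<close>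

theorem theorem4:
  fixes F :: "real^'n \<Rightarrow> ereal" and Fstar :: real
    and F\<gamma> :: "real^'n \<Rightarrow> real" and F\<gamma>star :: real and \<gamma> D \<alpha> R :: real
    and G :: "real^'n \<Rightarrow> real^'n" and B C :: "real^'n \<Rightarrow> real^'n"
    and blk :: "'n::finite \<Rightarrow> 'b::finite" and nrm :: "'b \<Rightarrow> real^'n \<Rightarrow> real" and L :: "'b \<Rightarrow> real"
    and M :: "'w measure" and idx :: "nat \<Rightarrow> 'w \<Rightarrow> 'b"
    and x0 :: "real^'n" and x :: "nat \<Rightarrow> 'w \<Rightarrow> real^'n" and k :: nat
  assumes F: "proper_closed_convex F"
    and Fstar: "\<exists>z\<in>minimizers F. F z = ereal Fstar"
    and norms: "\<And>i. is_norm_on (block_space blk i) (nrm i)"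
    and norms_ge: "\<And>i h. h \<in> block_space blk i \<Longrightarrow> norm h \<le> nrm i h"
    and gamma: "\<gamma> > 0" and D: "D \<ge> 0"
    and A1: "\<exists>z\<in>minimizers F\<gamma>. F\<gamma> z = F\<gamma>star" "F\<gamma>star \<le> Fstar"
    and A2: "\<And>z. z \<in> effective_domain F \<Longrightarrow>
               F (B z) - ereal (\<gamma> * D) \<le> ereal (F\<gamma> z) \<and> ereal (F\<gamma> z) \<le> F (C z)"
    and gradient: "\<And>z. GDERIV F\<gamma> z :> G z"
    and L_pos: "\<And>i. L i > 0"
    and A3: "block_lipschitz_gradient blk nrm L G"
    and A4: "convex_on UNIV F\<gamma>"
    and sampling: "random_blocks M idx L \<alpha>"
    and iterates: "\<And>j \<omega>. x j \<omega> = cd_iterate blk L G x0 (\<lambda>m. idx m \<omega>) j"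
    and A2_iterates: "\<And>j \<omega>. \<omega> \<in> space M \<Longrightarrow> F (B (x j \<omega>)) - ereal (\<gamma> * D) \<le> ereal (F\<gamma> (x j \<omega>))"
    and radius: "iterate_radius M x (minimizers F\<gamma>) (weighted_norm blk nrm L (1 - \<alpha>)) = ereal R"
  shows "ereal_expectation M (\<lambda>\<omega>. F (B (x k \<omega>))) - ereal Fstar
           \<le> ereal (2 * power_sum L \<alpha> * R\<^sup>2 / (real k + 4) + \<gamma> * D)"
proof -
  interpret block_smooth_convex F\<gamma> G blk nrm L
    by unfold_locales (fact gradient A4 norms norms_ge L_pos A3)+
  define S where "S = power_sum L \<alpha>"
  have S: "S > 0" unfolding S_def by (rule power_sum_pos[OF L_pos])
  interpret random_recursion M idx "\<lambda>i. L i powr \<alpha> / S"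
    "\<lambda>i u. u - (1 / L i) *\<^sub>R block_part blk i (G u)" x0 "cd_iterate blk L G x0"
    using sampling unfolding random_blocks_def
    by (intro random_recursion.intro random_recursion_axioms.intro) (simp_all add: S_def)
  have x: "x j = state j" for j by (rule ext) (simp add: iterates state_def)

  define \<phi> where "\<phi> u = F\<gamma> u - F\<gamma>star" for u
  define a where "a j = expectation (\<lambda>\<omega>. \<phi> (x j \<omega>))" for j
  have int: "integrable M (\<lambda>\<omega>. \<psi> (x j \<omega>))" for \<psi> :: "real^'n \<Rightarrow> real" and j
    unfolding x by (rule integrable_state)
  obtain z where z: "z \<in> minimizers F\<gamma>" "F\<gamma> z = F\<gamma>star" using A1(1) by blast
  have min_le: "F\<gamma> z' \<le> F\<gamma> u" if "z' \<in> minimizers F\<gamma>" for z' u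
    using that by (simp add: minimizers_def is_arg_min_linorder)
  have min_eq: "F\<gamma> z' = F\<gamma>star" if "z' \<in> minimizers F\<gamma>" for z'
    using min_le[OF that, of z] min_le[OF z(1), of z'] z(2) by simp
  have \<phi>_nonneg: "\<phi> u \<ge> 0" for u using min_le[OF z(1), of u] z(2) by (simp add: \<phi>_def)
  note within_radius = le_iterate_radius[OF radius]

  \<comment> \<open>solved for the distance, so that the bound holds for all minimizers and passes to \<open>R\<close>\<close>
  have gap_bound: "\<phi> (x j \<omega>) \<le> S / 2 * R\<^sup>2" if \<omega>: "\<omega> \<in> space M" for j \<omega>
  proof -
    have "sqrt (2 * \<phi> (x j \<omega>) / S) \<le> R"
    proof (rule within_radius[OF \<omega>])
      fix z' assume z': "z' \<in> minimizers F\<gamma>"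
      have "2 * \<phi> (x j \<omega>) / S \<le> (weighted_norm blk nrm L (1 - \<alpha>) (x j \<omega> - z'))\<^sup>2"
        using gap_le_weighted_dist[OF z', of "x j \<omega>" \<alpha>] S
        by (simp add: min_eq[OF z'] \<phi>_def S_def field_simps)
      then show "sqrt (2 * \<phi> (x j \<omega>) / S) \<le> weighted_norm blk nrm L (1 - \<alpha>) (x j \<omega> - z')"
        by (rule real_le_lsqrt[rotated]) (simp add: weighted_norm_def sum_nonneg)
    qed
    then have "2 * \<phi> (x j \<omega>) / S \<le> R\<^sup>2" by (rule sqrt_le_D)
    then show ?thesis using S by (simp add: field_simps)
  qed

  have gap_gradient: "(\<phi> (x j \<omega>))\<^sup>2 \<le> (dual_gradient_norm (1 - \<alpha>) (x j \<omega>))\<^sup>2 * R\<^sup>2"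
    if \<omega>: "\<omega> \<in> space M" for j \<omega>
  proof -
    define q where "q = dual_gradient_norm (1 - \<alpha>) (x j \<omega>)"
    have le: "\<phi> (x j \<omega>) \<le> q * weighted_norm blk nrm L (1 - \<alpha>) (x j \<omega> - z')"
      if "z' \<in> minimizers F\<gamma>" for z'
      using gap_le_gradient_times_dist[of "x j \<omega>" z' "1 - \<alpha>"] min_eq[OF that]
      by (simp add: \<phi>_def q_def)
    have "\<phi> (x j \<omega>) \<le> q * R"
    proof (cases "q = 0")
      case True
      then show ?thesis using le[OF z(1)] by simp
    next
      case False
      then have q: "q > 0" using dual_gradient_norm_nonneg[of "1 - \<alpha>" "x j \<omega>"] by (simp add: q_def)
      have "\<phi> (x j \<omega>) / q \<le> R"
        using le q by (intro within_radius[OF \<omega>]) (simp add: field_simps)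
      then show ?thesis using q by (simp add: field_simps)
    qed
    then have "(\<phi> (x j \<omega>))\<^sup>2 \<le> (q * R)\<^sup>2" by (intro power_mono \<phi>_nonneg)
    then show ?thesis by (simp add: q_def power_mult_distrib)
  qed

  have a_bound: "a j \<le> S / 2 * R\<^sup>2" for j
  proof -
    have "a j \<le> expectation (\<lambda>\<omega>. S / 2 * R\<^sup>2)"
      unfolding a_def using gap_bound by (intro integral_mono int) auto
    then show ?thesis by (simp add: prob_space)
  qed

  have rate: "a j \<le> 2 * S * R\<^sup>2 / (real j + 4)" for j
  proof (cases "R = 0")
    case True
    \<comment> \<open>here \<open>A\<close> vanishes, and the bound used for \<open>a 0\<close> forces every gap to be zero\<close>
    then show ?thesis using a_bound[of j] by simp
  next
    case False
    define A where "A = 2 * S * R\<^sup>2"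
    have A: "A > 0" using S False by (simp add: A_def)
    have step: "a (Suc j) \<le> a j - (a j)\<^sup>2 / A" for j
    proof -
      let ?T = "\<lambda>i u. u - (1 / L i) *\<^sub>R block_part blk i (G u)"
      have "a (Suc j) = expectation (\<lambda>\<omega>. \<Sum>i\<in>UNIV. L i powr \<alpha> / S * \<phi> (?T i (x j \<omega>)))"
        unfolding a_def x by (rule expectation_state_Suc)
      also have "\<dots> \<le> expectation (\<lambda>\<omega>. \<phi> (x j \<omega>) - (\<phi> (x j \<omega>))\<^sup>2 / A)"
      proof (rule integral_mono)
        show "integrable M (\<lambda>\<omega>. \<Sum>i\<in>UNIV. L i powr \<alpha> / S * \<phi> (?T i (x j \<omega>)))"
          by (rule int)
        show "integrable M (\<lambda>\<omega>. \<phi> (x j \<omega>) - (\<phi> (x j \<omega>))\<^sup>2 / A)"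
          by (rule int)
        fix \<omega> assume \<omega>: "\<omega> \<in> space M"
        let ?u = "x j \<omega>"
        have "(\<Sum>i\<in>UNIV. L i powr \<alpha> / S * \<phi> (?T i ?u))
            = (\<Sum>i\<in>UNIV. L i powr \<alpha> / S * F\<gamma> (?T i ?u)) - (\<Sum>i\<in>UNIV. L i powr \<alpha>) / S * F\<gamma>star"
          by (simp add: \<phi>_def right_diff_distrib sum_subtractf sum_divide_distrib sum_distrib_right)
        also have "(\<Sum>i\<in>UNIV. L i powr \<alpha>) / S = 1" using S by (simp add: S_def power_sum_def)
        finally have "(\<Sum>i\<in>UNIV. L i powr \<alpha> / S * \<phi> (?T i ?u))
            \<le> \<phi> ?u - (dual_gradient_norm (1 - \<alpha>) ?u)\<^sup>2 / (2 * S)"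
          using expected_step_decrease[of \<alpha> ?u] by (simp add: \<phi>_def S_def)
        moreover have "(\<phi> ?u)\<^sup>2 / A \<le> (dual_gradient_norm (1 - \<alpha>) ?u)\<^sup>2 / (2 * S)"
          using gap_gradient[OF \<omega>, of j] S False by (simp add: A_def field_simps)
        ultimately show "(\<Sum>i\<in>UNIV. L i powr \<alpha> / S * \<phi> (?T i ?u)) \<le> \<phi> ?u - (\<phi> ?u)\<^sup>2 / A"
          by linarith
      qed
      also have "\<dots> = a j - expectation (\<lambda>\<omega>. (\<phi> (x j \<omega>))\<^sup>2) / A"
        using int[of \<phi> j] int[of "\<lambda>u. (\<phi> u)\<^sup>2 / A" j] by (simp add: a_def)
      also have "\<dots> \<le> a j - (a j)\<^sup>2 / A"
        using A expectation_squared_le[of \<phi> j] by (simp add: a_def x divide_right_mono)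
      finally show ?thesis .
    qed
    have "a 0 \<le> A / 4" using a_bound[of 0] by (simp add: A_def)
    from decreasing_quadratic_recursion[OF A this step] show ?thesis by (simp add: A_def)
  qed

  obtain y where y: "y \<in> minimizers F" "F y = ereal Fstar" using Fstar by blast
  have F_ge: "ereal Fstar \<le> F u" for u
    using y by (simp add: minimizers_def is_arg_min_linorder)
  define r where "r u = real_of_ereal (F (B u))" for u
  have r: "F (B (x k \<omega>)) = ereal (r (x k \<omega>))" "r (x k \<omega>) \<le> F\<gamma> (x k \<omega>) + \<gamma> * D"
    if "\<omega> \<in> space M" for \<omega>
    using A2_iterates[OF that, of k] F_ge[of "B (x k \<omega>)"]
    by (cases "F (B (x k \<omega>))"; simp add: r_def)+
  have "ereal_expectation M (\<lambda>\<omega>. F (B (x k \<omega>))) = ereal_expectation M (\<lambda>\<omega>. ereal (r (x k \<omega>)))"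
    unfolding ereal_expectation_def using r(1) by (simp cong: nn_integral_cong)
  also have "\<dots> = ereal (expectation (\<lambda>\<omega>. r (x k \<omega>)))" by (rule ereal_expectation_ereal[OF int])
  finally have E: "ereal_expectation M (\<lambda>\<omega>. F (B (x k \<omega>))) = ereal (expectation (\<lambda>\<omega>. r (x k \<omega>)))" .
  have "expectation (\<lambda>\<omega>. r (x k \<omega>)) \<le> expectation (\<lambda>\<omega>. \<phi> (x k \<omega>) + (F\<gamma>star + \<gamma> * D))"
    using r(2) by (intro integral_mono int) (simp add: \<phi>_def)
  also have "\<dots> = a k + (F\<gamma>star + \<gamma> * D)" using int[of \<phi> k] by (simp add: a_def prob_space)
  finally show ?thesis using rate[of k] A1(2) by (simp add: E S_def)
qed

end
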